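(* Let $G$ be a graph of treewidth $t \geq 1$, and let $\omega$ be an integer with $2 \leq \omega \leq t$. If the largest clique in $G$ has at most $\omega$ vertices, then $\chi_f(G) \leq t + \frac{\omega - 1}{t}$.
   Context: Graphs are finite and simple. A $t$-tree is a graph obtained by starting with a $t$-clique and then iteratively adding vertices $v$ such that, at the time $v$ is added, its neighborhood $N(v)$ induces a $K_t$. A partial $t$-tree is a subgraph of a $t$-tree. The treewidth of $G$ is the minimum $t$ for which $G$ is a partial $t$-tree (this agrees with the usual definition of treewidth). A fractional coloring of $G$ assigns to each vertex $v \in V(G)$ a set $\phi(v) \subseteq \mathbb{R}$ of Lebesgue measure $\mu(\phi(v)) = 1$ so that $\phi(u) \cap \phi(v) = \emptyset$ for each edge $uv \in E(G)$. The fractional chromatic number $\chi_f(G)$ is the infimum of $\mu\left(\bigcup_{v \in V(G)} \phi(v)\right)$ over all fractional colorings $\phi$ of $G$. Equivalently, $\chi_f(G) = \inf_{b \geq 1} \chi_b(G)/b$, where $\chi_b(G)$ is the least $k$ such that one can assign to each vertex a $b$-element subset of $\{1,\dots,k\}$ with adjacent vertices receiving disjoint subsets. *)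

theory Defs
  imports "HOL-Analysis.Analysis" "HOL-Library.Ramsey"
begin

text \<open>A graph is given by its vertex set \<open>V\<close> and its set \<open>E\<close> of two-element edges.\<close>

definition fin_simple_graph :: "'a set \<Rightarrow> 'a set set \<Rightarrow> bool" where
  "fin_simple_graph V E \<longleftrightarrow> finite V \<and> E \<subseteq> nsets V 2"

definition clique_number :: "'a set \<Rightarrow> 'a set set \<Rightarrow> nat" where
  "clique_number V E = Max (card ` {K. K \<subseteq> V \<and> clique K E})"

inductive t_tree :: "nat \<Rightarrow> 'a set \<Rightarrow> 'a set set \<Rightarrow> bool" for t where
  base: "finite K \<Longrightarrow> card K = t \<Longrightarrow> t_tree t K (nsets K 2)"
| add: "t_tree t V E \<Longrightarrow> v \<notin> V \<Longrightarrow> K \<subseteq> V \<Longrightarrow> card K = t \<Longrightarrow> clique K E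
    \<Longrightarrow> t_tree t (insert v V) (E \<union> (\<lambda>u. {v, u}) ` K)"

text \<open>
  Being a subgraph is understood up to isomorphism.  The surrounding \<open>t\<close>-tree has vertices in
  \<open>nat\<close>, so that there is always room for vertices outside \<open>V\<close>, even if the type \<open>'a\<close> is finite;
  every \<open>t\<close>-tree, being finite, has an isomorphic copy on \<open>nat\<close>.
\<close>

definition partial_t_tree :: "nat \<Rightarrow> 'a set \<Rightarrow> 'a set set \<Rightarrow> bool" where
  "partial_t_tree t V E \<longleftrightarrow>
    (\<exists>(W :: nat set) F f. t_tree t W F \<and> inj_on f V \<and> f ` V \<subseteq> W \<and> (\<forall>e\<in>E. f ` e \<in> F))"

definition treewidth :: "'a set \<Rightarrow> 'a set set \<Rightarrow> nat" where
  "treewidth V E = (LEAST t. partial_t_tree t V E)"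

text \<open>The least element exists: a graph on \<open>n\<close> vertices is a subgraph of an \<open>n\<close>-clique.\<close>

lemma partial_t_tree_card:
  assumes "fin_simple_graph V E"
  shows "partial_t_tree (card V) V E"
proof -
  from assms have fin: "finite V" and E: "E \<subseteq> nsets V 2"
    by (auto simp: fin_simple_graph_def)
  obtain f :: "'a \<Rightarrow> nat" where f: "inj_on f V"
    using fin finite_imp_inj_to_nat_seg by blast
  have "t_tree (card V) (f ` V) (nsets (f ` V) 2)"
    using fin f by (intro t_tree.base) (auto simp: card_image)
  moreover have "f ` e \<in> nsets (f ` V) 2" if "e \<in> E" for e
    using that E f by (auto simp: nsets_def card_image inj_on_subset subset_iff)
  ultimately show ?thesis
    using f unfolding partial_t_tree_def by blast
qed

definition fractional_coloring :: "'a set \<Rightarrow> 'a set set \<Rightarrow> ('a \<Rightarrow> real set) \<Rightarrow> bool" where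
  "fractional_coloring V E \<phi> \<longleftrightarrow>
    (\<forall>v\<in>V. \<phi> v \<in> sets lebesgue \<and> emeasure lebesgue (\<phi> v) = 1) \<and>
    (\<forall>u\<in>V. \<forall>v\<in>V. {u, v} \<in> E \<longrightarrow> \<phi> u \<inter> \<phi> v = {})"

text \<open>
  For a finite graph the union below has finite measure, so \<open>measure\<close> agrees with \<open>emeasure\<close>, and
  fractional colorings exist, so the infimum is taken over a nonempty set bounded below by \<open>0\<close>.
\<close>

definition fractional_chromatic_number :: "'a set \<Rightarrow> 'a set set \<Rightarrow> real" where
  "fractional_chromatic_number V E =
    (INF \<phi>\<in>{\<phi>. fractional_coloring V E \<phi>}. measure lebesgue (\<Union>v\<in>V. \<phi> v))"

lemma fractional_coloring_exists:
  assumes "fin_simple_graph V E"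
  shows "\<exists>\<phi>. fractional_coloring V E \<phi>"
proof -
  from assms have fin: "finite V" and E: "E \<subseteq> nsets V 2"
    by (auto simp: fin_simple_graph_def)
  obtain f :: "'a \<Rightarrow> nat" where f: "inj_on f V"
    using fin finite_imp_inj_to_nat_seg by blast
  define \<phi> :: "'a \<Rightarrow> real set" where "\<phi> v = {real (f v)..<real (f v) + 1}" for v
  have "\<phi> u \<inter> \<phi> v = {}" if "u \<in> V" "v \<in> V" "{u, v} \<in> E" for u v
  proof -
    have "u \<noteq> v" using that E by (auto simp: nsets_def)
    then have "f u \<noteq> f v" using f that by (auto dest: inj_onD)
    then show ?thesis unfolding \<phi>_def by auto
  qed
  then have "fractional_coloring V E \<phi>"
    unfolding fractional_coloring_def by (auto simp: \<phi>_def)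
  then show ?thesis by blast
qed

end

theory Submission
  imports Defs
begin

text \<open>
  Give every vertex \<open>t\<close> of \<open>t\<^sup>2 + \<omega> - 1\<close> colors so that, within each clique of the surrounding
  \<open>t\<close>-tree, two vertices not adjacent in \<open>G\<close> share exactly one color and no color occurs on three
  vertices.  Such a coloring extends greedily along the construction of the \<open>t\<close>-tree: when \<open>v\<close> is
  attached to the \<open>t\<close>-clique \<open>K\<close>, each \<open>u \<in> K\<close> shares colors with at most \<open>t - 1\<close> other vertices of
  \<open>K\<close>, so it has a color private to it in \<open>K\<close>, which is handed to \<open>v\<close> if \<open>u\<close> and \<open>v\<close> are not
  adjacent.  The rest of the colors of \<open>v\<close> are new to \<open>K\<close>; there are enough of them, since
  \<open>K \<union> {v}\<close> needs \<open>t (t + 1)\<close> colors minus its number of non-edges, and this number is at least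
  \<open>t + 1 - \<omega>\<close> because deleting one end of each non-edge leaves a clique.
\<close>

section \<open>Non-adjacent pairs within a vertex set, and the cliques they leave over\<close>

definition non_edges :: "'a set set \<Rightarrow> 'a set \<Rightarrow> 'a set set" where
  "non_edges E S = nsets S 2 - E"

lemma finite_non_edges: "finite S \<Longrightarrow> finite (non_edges E S)"
  by (simp add: non_edges_def finite_imp_finite_nsets)

text \<open>The recursion that drives the inductions over bags: the pairs gained with
  \<open>x\<close> correspond to its non-neighbors in \<open>S\<close>.\<close>

lemma card_non_edges_insert:
  assumes "finite S" "x \<notin> S"
  shows "card (non_edges E (insert x S)) = card (non_edges E S) + card {u \<in> S. {u, x} \<notin> E}"
proof -
  have "nsets (insert x S) 2 = nsets S 2 \<union> (\<lambda>u. {u, x}) ` S"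
  proof (intro equalityI subsetI)
    fix e assume "e \<in> nsets (insert x S) 2"
    then obtain a b where "e = {a, b}" "a \<in> insert x S" "b \<in> insert x S" "a \<noteq> b"
      by (rule nsets2_E)
    then show "e \<in> nsets S 2 \<union> (\<lambda>u. {u, x}) ` S"
      by (cases "a = x"; cases "b = x") (simp_all add: image_iff doubleton_eq_iff)
  next
    fix e assume "e \<in> nsets S 2 \<union> (\<lambda>u. {u, x}) ` S"
    moreover have "nsets S 2 \<subseteq> nsets (insert x S) 2"
      by (intro nsets_mono subset_insertI)
    moreover have "{u, x} \<in> nsets (insert x S) 2" if "u \<in> S" for u
      using that \<open>x \<notin> S\<close> by auto
    ultimately show "e \<in> nsets (insert x S) 2" by blast
  qed
  then have eq: "non_edges E (insert x S) = non_edges E S \<union> (\<lambda>u. {u, x}) ` {u \<in> S. {u, x} \<notin> E}"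
    unfolding non_edges_def by blast
  have inj: "inj_on (\<lambda>u. {u, x}) {u \<in> S. {u, x} \<notin> E}"
    using assms by (auto simp: inj_on_def doubleton_eq_iff)
  have disj: "non_edges E S \<inter> (\<lambda>u. {u, x}) ` {u \<in> S. {u, x} \<notin> E} = {}"
    using assms by (auto simp: non_edges_def nsets_def)
  show ?thesis
    unfolding eq using assms disj
    by (subst card_Un_disjoint) (auto simp: finite_non_edges card_image[OF inj])
qed

text \<open>Built up one vertex at a time: \<open>x\<close> joins \<open>Q\<close> if it is adjacent
  to all of \<open>S\<close>; otherwise at least one new non-edge pays for leaving it out.\<close>

lemma large_clique_if_few_non_edges:
  assumes "finite S"
  shows "\<exists>Q\<subseteq>S. clique Q E \<and> card S \<le> card Q + card (non_edges E S)"
  using assms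
proof (induction S rule: finite_induct)
  case empty
  then show ?case by simp
next
  case (insert x S)
  then obtain Q where Q: "Q \<subseteq> S" "clique Q E" "card S \<le> card Q + card (non_edges E S)"
    by blast
  let ?N = "{u \<in> S. {u, x} \<notin> E}"
  have fin: "finite Q" using Q(1) insert.hyps(1) by (rule finite_subset)
  show ?case
  proof (cases "?N = {}")
    case True
    then have "clique (insert x Q) E"
      using Q by (auto simp: clique_def insert_commute)
    moreover have "card (insert x Q) = Suc (card Q)"
      using Q insert.hyps fin by (subst card_insert_disjoint) auto
    ultimately show ?thesis
      using Q insert.hyps by (intro exI[of _ "insert x Q"]) (auto simp: card_non_edges_insert)
  next
    case False
    then have "card ?N \<ge> 1"
      using insert.hyps by (simp add: Suc_leI card_gt_0_iff)
    then show ?thesis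
      using Q insert.hyps by (intro exI[of _ Q]) (auto simp: card_non_edges_insert)
  qed
qed

section \<open>Colorings of a single bag and the number of colors they use\<close>

text \<open>Asking for exactly one common color, together with the third clause, puts the colors
  that occur twice on \<open>S\<close> in bijection with the non-edges of \<open>S\<close>. Hence
  the number of colors used on a bag is determined by its size and its number of non-edges.\<close>

definition bag_coloring ::
    "nat \<Rightarrow> nat \<Rightarrow> 'a set set \<Rightarrow> 'a set \<Rightarrow> ('a \<Rightarrow> nat set) \<Rightarrow> bool" where
  "bag_coloring t M E S c \<longleftrightarrow>
    (\<forall>u\<in>S. c u \<subseteq> {..<M} \<and> card (c u) = t) \<and>
    (\<forall>u\<in>S. \<forall>v\<in>S. u \<noteq> v \<longrightarrow> card (c u \<inter> c v) = (if {u, v} \<in> E then 0 else 1)) \<and>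
    (\<forall>u\<in>S. \<forall>v\<in>S. \<forall>w\<in>S. u \<noteq> v \<and> v \<noteq> w \<and> u \<noteq> w \<longrightarrow> c u \<inter> c v \<inter> c w = {})"

lemma
  assumes "bag_coloring t M E S c" "u \<in> S"
  shows bag_coloring_colors: "c u \<subseteq> {..<M}"
    and bag_coloring_card: "card (c u) = t"
    and bag_coloring_shared: "v \<in> S \<Longrightarrow> u \<noteq> v \<Longrightarrow> card (c u \<inter> c v) = (if {u, v} \<in> E then 0 else 1)"
    and bag_coloring_triple: "v \<in> S \<Longrightarrow> w \<in> S \<Longrightarrow> u \<noteq> v \<Longrightarrow> v \<noteq> w \<Longrightarrow> u \<noteq> w \<Longrightarrow>
      c u \<inter> c v \<inter> c w = {}"
  using assms unfolding bag_coloring_def by simp_all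

lemma bag_coloring_subset:
  assumes "bag_coloring t M E S c" "R \<subseteq> S"
  shows "bag_coloring t M E R c"
  unfolding bag_coloring_def[of t M E R]
  using bag_coloring_colors[OF assms(1)] bag_coloring_card[OF assms(1)]
    bag_coloring_shared[OF assms(1)] bag_coloring_triple[OF assms(1)] assms(2)[THEN subsetD]
  by simp

lemma bag_coloring_cong:
  "(\<And>u. u \<in> S \<Longrightarrow> c u = d u) \<Longrightarrow> bag_coloring t M E S c \<longleftrightarrow> bag_coloring t M E S d"
  unfolding bag_coloring_def by simp

lemma bag_coloring_finite: "bag_coloring t M E S c \<Longrightarrow> u \<in> S \<Longrightarrow> finite (c u)"
  by (rule finite_subset[OF bag_coloring_colors finite_lessThan])

text \<open>No color lies on three vertices, so the colors that \<open>x\<close> shares with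
  different vertices of \<open>S\<close> are distinct, and each non-neighbor accounts for
  one.\<close>

lemma card_shared_colors:
  assumes c: "bag_coloring t M E (insert x S) c" and "finite S" "x \<notin> S"
  shows "card (c x \<inter> (\<Union>u\<in>S. c u)) = card {u \<in> S. {u, x} \<notin> E}"
proof -
  have "card (c x \<inter> (\<Union>u\<in>S. c u)) = card (\<Union>u\<in>S. c u \<inter> c x)"
    by (rule arg_cong[of _ _ card]) auto
  also have "\<dots> = (\<Sum>u\<in>S. card (c u \<inter> c x))"
  proof (rule card_UN_disjoint)
    show "\<forall>u\<in>S. \<forall>w\<in>S. u \<noteq> w \<longrightarrow> c u \<inter> c x \<inter> (c w \<inter> c x) = {}"
    proof (intro ballI impI)
      fix u w assume "u \<in> S" "w \<in> S" "u \<noteq> w"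
      moreover from this have "u \<noteq> x" "w \<noteq> x" using \<open>x \<notin> S\<close> by auto
      ultimately have "c u \<inter> c w \<inter> c x = {}"
        using bag_coloring_triple[OF c] by simp
      then show "c u \<inter> c x \<inter> (c w \<inter> c x) = {}" by blast
    qed
  qed (use assms in \<open>auto dest: bag_coloring_finite\<close>)
  also have "\<dots> = (\<Sum>u\<in>S. if {u, x} \<in> E then 0 else 1)"
    using \<open>x \<notin> S\<close> by (intro sum.cong refl bag_coloring_shared[OF c]) auto
  also have "\<dots> = card {u \<in> S. {u, x} \<notin> E}"
    using \<open>finite S\<close> by (simp add: sum.If_cases Int_def)
  finally show ?thesis .
qed

text \<open>Inclusion-exclusion without triple intersections: counting \<open>t\<close> colors per
  vertex counts the color of each non-edge twice.\<close>

lemma card_colors: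
  assumes "finite S" "bag_coloring t M E S c"
  shows "card (\<Union>u\<in>S. c u) + card (non_edges E S) = t * card S"
  using assms
proof (induction S rule: finite_induct)
  case empty
  have "non_edges E {} = {}" by (auto simp: non_edges_def nsets_def)
  then show ?case by simp
next
  case (insert x S)
  have c: "bag_coloring t M E S c"
    using insert.prems by (rule bag_coloring_subset) auto
  have fin: "finite (c x)" "finite (\<Union>u\<in>S. c u)"
    using insert.hyps bag_coloring_finite[OF insert.prems] by auto
  have "card (c x) = t"
    using bag_coloring_card[OF insert.prems] by simp
  then have "card (c x \<union> (\<Union>u\<in>S. c u)) + card {u \<in> S. {u, x} \<notin> E} = t + card (\<Union>u\<in>S. c u)"
    using card_Un_Int[OF fin] card_shared_colors[OF insert.prems insert.hyps] by simp
  then show ?case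
    using insert.IH[OF c] insert.hyps by (simp add: card_non_edges_insert)
qed

lemma bag_coloring_private_color:
  assumes c: "bag_coloring t M E K c" and "finite K" "card K \<le> t" "u \<in> K"
  shows "\<exists>p\<in>c u. \<forall>w\<in>K. w \<noteq> u \<longrightarrow> p \<notin> c w"
proof (rule ccontr)
  assume contr: "\<not> ?thesis"
  have ins: "insert u (K - {u}) = K" using \<open>u \<in> K\<close> by blast
  \<comment> \<open>If every color of \<open>u\<close> were shared, its \<open>t\<close> colors
    would be matched by distinct non-neighbors in \<open>K - {u}\<close>, which has fewer than
    \<open>t\<close> elements.\<close>
  have "c u \<inter> (\<Union>w\<in>K - {u}. c w) = c u" using contr by blast
  then have "card (c u) = card {w \<in> K - {u}. {w, u} \<notin> E}"
    using card_shared_colors[of t M E u "K - {u}" c] c ins \<open>finite K\<close> by simp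
  also have "\<dots> \<le> card (K - {u})"
    using \<open>finite K\<close> by (intro card_mono) auto
  also have "\<dots> < card K"
    using assms by (intro psubset_card_mono) auto
  also have "\<dots> \<le> t" by fact
  finally show False
    using bag_coloring_card[OF c \<open>u \<in> K\<close>] by simp
qed

text \<open>Allowing \<open>card K < t\<close> lets the same step also build the coloring of the
  initial clique. The colors on \<open>K\<close> stay fixed, so that the bags colored before remain
  valid.\<close>

lemma bag_coloring_extend:
  assumes c: "bag_coloring t (t\<^sup>2 + \<omega> - 1) E K c"
    and K: "finite K" "card K \<le> t" and v: "v \<notin> K"
    and \<omega>: "\<And>Q. Q \<subseteq> insert v K \<Longrightarrow> clique Q E \<Longrightarrow> card Q \<le> \<omega>"
    and t: "t \<ge> 1"
  shows "\<exists>D. bag_coloring t (t\<^sup>2 + \<omega> - 1) E (insert v K) (c(v := D))"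
proof -
  let ?M = "t\<^sup>2 + \<omega> - 1"
  let ?U = "\<Union>u\<in>K. c u"
  define N where "N = {u \<in> K. {u, v} \<notin> E}"
  have finN: "finite N" and NK: "N \<subseteq> K" using K by (auto simp: N_def)
  have cardN: "card N \<le> t" using card_mono[OF K(1) NK] K(2) by simp
  obtain p where p: "\<And>u. u \<in> K \<Longrightarrow> p u \<in> c u"
      and priv: "\<And>u w. u \<in> K \<Longrightarrow> w \<in> K \<Longrightarrow> w \<noteq> u \<Longrightarrow> p u \<notin> c w"
    using bag_coloring_private_color[OF c K] by metis
  have inj: "inj_on p N"
  proof (rule inj_onI, rule ccontr)
    fix u w assume "u \<in> N" "w \<in> N" "p u = p w" "u \<noteq> w"
    then show False using p[of w] priv[of u w] NK by auto
  qed
  have finU: "finite ?U" using K bag_coloring_finite[OF c] by auto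
  have UM: "?U \<subseteq> {..<?M}" using bag_coloring_colors[OF c] by blast
  \<comment> \<open>Since \<open>card Q \<le> \<omega>\<close>, the enlarged bag has at least
    \<open>card K + 1 - \<omega>\<close> non-edges, and those at \<open>v\<close> correspond to
    \<open>N\<close>.\<close>
  obtain Q where Q: "Q \<subseteq> insert v K" "clique Q E"
      "card (insert v K) \<le> card Q + card (non_edges E (insert v K))"
    using large_clique_if_few_non_edges[of "insert v K" E] K by auto
  then have "card K + 1 \<le> \<omega> + card (non_edges E K) + card N"
    using \<omega>[OF Q(1,2)] K v by (simp add: card_non_edges_insert N_def)
  \<comment> \<open>The enlarged bag needs \<open>t * (card K + 1)\<close> colors minus its
    non-edges. Split the product into \<open>(t - 1) * (card K + 1)\<close>, which is at most
    \<open>t\<^sup>2 - 1\<close>, and \<open>card K + 1\<close>, which is at most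
    \<open>\<omega>\<close> plus the number of non-edges.\<close>
  moreover have "(t - 1) * (card K + 1) \<le> (t - 1) * (t + 1)"
    using K by (intro mult_left_mono) auto
  moreover have "(t - 1) * (t + 1) + 1 = t\<^sup>2" "(t - 1) * (card K + 1) + card K + 1 = t * card K + t"
    using t by (cases t; simp add: power2_eq_square algebra_simps)+
  moreover have "card ?U + card (non_edges E K) = t * card K"
    using card_colors[OF K(1) c] .
  ultimately have "t - card N \<le> ?M - card ?U"
    using cardN by linarith
  also have "\<dots> = card ({..<?M} - ?U)"
    using UM finU by (simp add: card_Diff_subset)
  finally obtain T where T: "T \<subseteq> {..<?M} - ?U" "card T = t - card N" "finite T"
    by (rule obtain_subset_with_card_n)
  define D where "D = p ` N \<union> T"
  have pU: "p ` N \<subseteq> ?U" using p NK by auto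
  have "card D = card (p ` N) + card T"
    unfolding D_def using T finN pU by (intro card_Un_disjoint) auto
  then have cardD: "card D = t"
    using T(2) cardN card_image[OF inj] by simp
  have DM: "D \<subseteq> {..<?M}"
    unfolding D_def using T pU UM by blast
  \<comment> \<open>\<open>T\<close> avoids all colors of \<open>K\<close>, and a private color
    \<open>p w\<close> lies in \<open>c u\<close> only for \<open>w = u\<close>.\<close>
  have shared: "c u \<inter> D = (if {u, v} \<in> E then {} else {p u})" if "u \<in> K" for u
  proof (intro equalityI subsetI)
    fix x assume x: "x \<in> c u \<inter> D"
    then have "x \<notin> T" using T(1) that by blast
    then obtain w where w: "w \<in> N" "x = p w" using x unfolding D_def by blast
    then have "w = u" using priv[of w u] x that NK by blast
    then show "x \<in> (if {u, v} \<in> E then {} else {p u})" using w by (simp add: N_def)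
  next
    fix x assume "x \<in> (if {u, v} \<in> E then {} else {p u})"
    then have "{u, v} \<notin> E" "x = p u" by (simp_all split: if_splits)
    then show "x \<in> c u \<inter> D" using that p by (simp add: D_def N_def)
  qed
  then have cshared: "card (c u \<inter> D) = (if {u, v} \<in> E then 0 else 1)" if "u \<in> K" for u
    using that by simp
  have triple: "c u \<inter> c w \<inter> D = {}" if "u \<in> K" "w \<in> K" "u \<noteq> w" for u w
  proof -
    have "c u \<inter> c w \<inter> D = c w \<inter> (c u \<inter> D)" by blast
    also have "\<dots> = {}" using shared[OF that(1)] priv[of u w] that by simp
    finally show ?thesis .
  qed
  have "bag_coloring t ?M E (insert v K) (c(v := D))"
    unfolding bag_coloring_def
  proof (intro conjI ballI impI)
    fix u assume "u \<in> insert v K"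
    then show "(c(v := D)) u \<subseteq> {..<?M}" "card ((c(v := D)) u) = t"
      using bag_coloring_colors[OF c] bag_coloring_card[OF c] DM cardD by auto
  next
    fix u w assume "u \<in> insert v K" "w \<in> insert v K" "u \<noteq> w"
    then show "card ((c(v := D)) u \<inter> (c(v := D)) w) = (if {u, w} \<in> E then 0 else 1)"
      using bag_coloring_shared[OF c, of u w] cshared[of u] cshared[of w]
      by (cases "u = v"; cases "w = v") (simp_all add: Int_commute insert_commute)
  next
    fix x y z assume xyz: "x \<in> insert v K" "y \<in> insert v K" "z \<in> insert v K"
      "x \<noteq> y \<and> y \<noteq> z \<and> x \<noteq> z"
    have "c x \<inter> c y \<inter> c z = {}" if "x \<in> K" "y \<in> K" "z \<in> K"
      using bag_coloring_triple[OF c] xyz that by simp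
    then show "(c(v := D)) x \<inter> (c(v := D)) y \<inter> (c(v := D)) z = {}"
      using xyz triple[of x y] triple[of y z] triple[of x z]
      by (cases "x = v"; cases "y = v"; cases "z = v") (simp_all add: Int_ac)
  qed
  then show ?thesis ..
qed

text \<open>Supplies the coloring of the clique from which a t-tree starts.\<close>

lemma bag_coloring_exists:
  assumes "finite K" "card K \<le> t" "t \<ge> 1"
    and "\<And>Q. Q \<subseteq> K \<Longrightarrow> clique Q E \<Longrightarrow> card Q \<le> \<omega>"
  shows "\<exists>c. bag_coloring t (t\<^sup>2 + \<omega> - 1) E K c"
  using assms
proof (induction K rule: finite_induct)
  case empty
  then show ?case by (simp add: bag_coloring_def)
next
  case (insert v K)
  have "card K \<le> t" using insert.hyps insert.prems by simp
  moreover have "\<And>Q. Q \<subseteq> K \<Longrightarrow> clique Q E \<Longrightarrow> card Q \<le> \<omega>"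
    using insert.prems(3) by (meson subset_insertI2)
  ultimately obtain c where "bag_coloring t (t\<^sup>2 + \<omega> - 1) E K c"
    using insert.IH insert.prems(2) by blast
  then show ?case
    using bag_coloring_extend insert.hyps insert.prems \<open>card K \<le> t\<close> by metis
qed

section \<open>Coloring a whole t-tree along its construction\<close>

lemma t_tree_edges: "t_tree t W F \<Longrightarrow> F \<subseteq> nsets W 2"
proof (induction rule: t_tree.induct)
  case (add V E v K)
  then have "{v, u} \<in> nsets (insert v V) 2" if "u \<in> K" for u
    using that by auto
  moreover have "nsets V 2 \<subseteq> nsets (insert v V) 2" by (intro nsets_mono) auto
  ultimately show ?case using add.IH by blast
qed simp

lemma t_tree_finite: "t_tree t W F \<Longrightarrow> finite W"
  by (induction rule: t_tree.induct) auto

text \<open>Here \<open>F\<close> determines the bags, while \<open>E\<close> decides which pairs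
  share a color; a single \<open>c\<close> serves all bags at once. When \<open>v\<close> is added,
  a clique containing \<open>v\<close> lies in \<open>insert v K\<close>, and any other clique is an
  old one whose colors have not changed.\<close>

lemma t_tree_coloring:
  assumes "t_tree t W F" "t \<ge> 1"
    and "\<And>Q. Q \<subseteq> W \<Longrightarrow> clique Q E \<Longrightarrow> card Q \<le> \<omega>"
  shows "\<exists>c. \<forall>B\<subseteq>W. clique B F \<longrightarrow> bag_coloring t (t\<^sup>2 + \<omega> - 1) E B c"
  using assms
proof (induction rule: t_tree.induct)
  case (base K)
  then obtain c where "bag_coloring t (t\<^sup>2 + \<omega> - 1) E K c"
    using bag_coloring_exists[of K t E \<omega>] by auto
  then show ?case using bag_coloring_subset by blast
next
  case (add V F v K)
  have "\<And>Q. Q \<subseteq> V \<Longrightarrow> clique Q E \<Longrightarrow> card Q \<le> \<omega>"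
    using add.prems(2) by (meson subset_insertI2)
  then obtain c where c: "\<And>B. B \<subseteq> V \<Longrightarrow> clique B F \<Longrightarrow> bag_coloring t (t\<^sup>2 + \<omega> - 1) E B c"
    using add.IH add.prems(1) by blast
  have FV: "e \<subseteq> V" if "e \<in> F" for e
    using that t_tree_edges[OF add.hyps(1)] by (auto simp: nsets_def)
  have "finite K" using add.hyps(3) t_tree_finite[OF add.hyps(1)] by (rule finite_subset)
  moreover have "\<And>Q. Q \<subseteq> insert v K \<Longrightarrow> clique Q E \<Longrightarrow> card Q \<le> \<omega>"
    using add.prems(2) add.hyps(3) by (meson insert_mono subset_trans)
  ultimately obtain D where D: "bag_coloring t (t\<^sup>2 + \<omega> - 1) E (insert v K) (c(v := D))"
    using bag_coloring_extend[OF c[OF add.hyps(3,5)]] add.hyps(2-4) add.prems(1) by blast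
  have "bag_coloring t (t\<^sup>2 + \<omega> - 1) E B (c(v := D))"
    if B: "B \<subseteq> insert v V" "clique B (F \<union> (\<lambda>u. {v, u}) ` K)" for B
  proof (cases "v \<in> B")
    case True
    have "B \<subseteq> insert v K"
    proof
      fix u assume u: "u \<in> B"
      show "u \<in> insert v K"
      proof (cases "u = v")
        case False
        then have "{v, u} \<in> F \<union> (\<lambda>u. {v, u}) ` K"
          using B(2) True u by (auto simp: clique_def)
        moreover have "{v, u} \<notin> F" using FV add.hyps(2) by blast
        ultimately show ?thesis by (auto simp: doubleton_eq_iff)
      qed simp
    qed
    then show ?thesis using D bag_coloring_subset by blast
  next
    case False
    then have "{a, b} \<in> F" if "a \<in> B" "b \<in> B" "a \<noteq> b" for a b
      using B(2) that False unfolding clique_def by (fastforce simp: doubleton_eq_iff)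
    then have "clique B F" by (simp add: clique_def)
    moreover have "B \<subseteq> V" using False B by blast
    ultimately have "bag_coloring t (t\<^sup>2 + \<omega> - 1) E B c" by (rule c[rotated])
    moreover have "c u = (c(v := D)) u" if "u \<in> B" for u using that False by auto
    ultimately show ?thesis using bag_coloring_cong by blast
  qed
  then show ?case by blast
qed

section \<open>Passing between the graph and its copy inside a t-tree\<close>

lemma partial_t_tree_treewidth:
  "fin_simple_graph V E \<Longrightarrow> partial_t_tree (treewidth V E) V E"
  unfolding treewidth_def using partial_t_tree_card by (rule LeastI)

lemma card_clique_le_clique_number:
  assumes "finite V" "Q \<subseteq> V" "clique Q E"
  shows "card Q \<le> clique_number V E"
  unfolding clique_number_def using assms by (intro Max_ge finite_imageI) auto

text \<open>Pulls cliques of the copy back to \<open>V\<close>, where the clique number bounds them.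
  The bound \<open>2\<close> matters because a single vertex is a clique even outside the image of
  \<open>f\<close>.\<close>

lemma clique_image:
  assumes "inj_on f V" "E \<subseteq> nsets V 2" "clique Q ((`) f ` E)" "card Q \<ge> 2"
  shows "\<exists>R\<subseteq>V. clique R E \<and> card R = card Q"
proof -
  have edge: "\<exists>e\<in>E. {a, b} = f ` e" if "a \<in> Q" "b \<in> Q" "a \<noteq> b" for a b
    using that assms(3) by (auto simp: clique_def image_iff)
  have "Q \<subseteq> f ` V"
  proof
    fix a assume a: "a \<in> Q"
    \<comment> \<open>A second element \<open>b\<close> of \<open>Q\<close> puts \<open>a\<close> on
      an edge of the copy, hence in the image of \<open>f\<close>.\<close>
    have "\<not> Q \<subseteq> {a}"
      using assms(4) card_mono[of "{a}" Q] by auto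
    then obtain b where "b \<in> Q" "a \<noteq> b" by auto
    then obtain e where "e \<in> E" "{a, b} = f ` e" using edge a by blast
    then show "a \<in> f ` V" using assms(2) by (fastforce simp: nsets_def)
  qed
  then obtain R where R: "R \<subseteq> V" "Q = f ` R" by (meson subset_imageE)
  have inj: "inj_on f R" using assms(1) R(1) inj_on_subset by blast
  have "{x, y} \<in> E" if xy: "x \<in> R" "y \<in> R" "x \<noteq> y" for x y
  proof -
    have "f x \<noteq> f y" using inj xy by (auto dest: inj_onD)
    then obtain e where e: "e \<in> E" "{f x, f y} = f ` e" using edge xy R(2) by blast
    have "e \<subseteq> V" using e(1) assms(2) by (auto simp: nsets_def)
    moreover have "f ` {x, y} = f ` e" using e(2) by simp
    ultimately have "{x, y} = e"
      using inj_on_image_eq_iff[OF assms(1)] xy R(1) by (metis bot_least insert_subset subsetD)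
    then show ?thesis using e(1) by simp
  qed
  then have "clique R E" by (simp add: clique_def)
  moreover have "card R = card Q" using R(2) inj by (simp add: card_image)
  ultimately show ?thesis using R(1) by blast
qed

lemma partial_t_tree_coloring:
  assumes G: "fin_simple_graph V E" and "partial_t_tree t V E" "t \<ge> 1"
    and "1 \<le> \<omega>" "clique_number V E \<le> \<omega>"
  obtains c where "\<And>v. v \<in> V \<Longrightarrow> c v \<subseteq> {..<t\<^sup>2 + \<omega> - 1}" "\<And>v. v \<in> V \<Longrightarrow> card (c v) = t"
    "\<And>u v. {u, v} \<in> E \<Longrightarrow> c u \<inter> c v = {}"
proof -
  have fin: "finite V" and E: "E \<subseteq> nsets V 2"
    using G by (auto simp: fin_simple_graph_def)
  obtain W :: "nat set" and F f where W: "t_tree t W F" "inj_on f V" "f ` V \<subseteq> W"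
      and F: "\<And>e. e \<in> E \<Longrightarrow> f ` e \<in> F"
    using assms(2) unfolding partial_t_tree_def by blast
  \<comment> \<open>Cliques with at least two vertices come from \<open>G\<close>; the remaining
    ones are covered by \<open>1 \<le> \<omega>\<close>.\<close>
  have clq: "card Q \<le> \<omega>" if Q: "clique Q ((`) f ` E)" for Q
  proof (cases "card Q \<ge> 2")
    case True
    then obtain R where "R \<subseteq> V" "clique R E" "card R = card Q"
      using clique_image[OF W(2) E Q True] by blast
    then show ?thesis
      using card_clique_le_clique_number[OF fin] assms(5) le_trans by metis
  qed (use assms(4) in linarith)
  have "\<exists>c. \<forall>B\<subseteq>W. clique B F \<longrightarrow> bag_coloring t (t\<^sup>2 + \<omega> - 1) ((`) f ` E) B c"
    by (rule t_tree_coloring[OF W(1) \<open>t \<ge> 1\<close> clq])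
  then obtain c where c: "\<And>B. B \<subseteq> W \<Longrightarrow> clique B F \<Longrightarrow>
      bag_coloring t (t\<^sup>2 + \<omega> - 1) ((`) f ` E) B c"
    by blast
  show thesis
  proof (rule that[of "c \<circ> f"])
    fix v assume "v \<in> V"
    then have "bag_coloring t (t\<^sup>2 + \<omega> - 1) ((`) f ` E) {f v} c"
      using W(3) by (intro c) (auto simp: clique_def)
    then show "(c \<circ> f) v \<subseteq> {..<t\<^sup>2 + \<omega> - 1}" "card ((c \<circ> f) v) = t"
      using bag_coloring_colors bag_coloring_card by fastforce+
  next
    fix u v assume uv: "{u, v} \<in> E"
    then have V: "u \<in> V" "v \<in> V" "u \<noteq> v" using E by (auto simp: nsets_def)
    then have ne: "f u \<noteq> f v" using W(2) by (auto dest: inj_onD)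
    have im: "{f u, f v} \<in> (`) f ` E" using uv by (metis image_empty image_eqI image_insert)
    \<comment> \<open>Adjacent vertices of the graph thus land in a common bag, where disjointness
      of their colors is guaranteed.\<close>
    have "{f u, f v} \<in> F" using F[OF uv] by simp
    then have bag: "bag_coloring t (t\<^sup>2 + \<omega> - 1) ((`) f ` E) {f u, f v} c"
      using W(3) V by (intro c) (auto simp: clique_def insert_commute)
    then have "card (c (f u) \<inter> c (f v)) = 0"
      using ne im bag_coloring_shared[OF bag] by simp
    then show "(c \<circ> f) u \<inter> (c \<circ> f) v = {}"
      using bag_coloring_finite[OF bag] by simp
  qed
qed

section \<open>From b-fold colorings to fractional colorings\<close>

lemma fractional_chromatic_number_le_if_coloring:
  fixes c :: "'a \<Rightarrow> nat set"
  assumes "b \<ge> 1" and colors: "\<And>v. v \<in> V \<Longrightarrow> c v \<subseteq> {..<k}" "\<And>v. v \<in> V \<Longrightarrow> card (c v) = b"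
    and disjoint: "\<And>u v. {u, v} \<in> E \<Longrightarrow> c u \<inter> c v = {}"
  shows "fractional_chromatic_number V E \<le> real k / real b"
proof -
  \<comment> \<open>Each color becomes an interval of length \<open>1 / real b\<close>, so
    \<open>b\<close> colors have total measure 1. Half-open ends make the intervals disjoint, and
    membership can then be read off from a floor.\<close>
  define I where "I i = {real i / real b..<(real i + 1) / real b}" for i :: nat
  define \<phi> where "\<phi> v = (\<Union>i\<in>c v. I i)" for v
  have mem: "x \<in> I i \<longleftrightarrow> \<lfloor>x * real b\<rfloor> = int i" for x i
    using \<open>b \<ge> 1\<close> by (auto simp: I_def floor_eq_iff field_simps)
  have disjI: "disjoint_family_on I A" for A
    unfolding disjoint_family_on_def using mem by auto
  have fin: "finite (c v)" if "v \<in> V" for v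
    using colors(1)[OF that] by (rule finite_subset) simp
  have meas: "I i \<in> sets lebesgue" "emeasure lebesgue (I i) = ennreal (1 / real b)" for i
    by (auto simp: I_def divide_right_mono diff_divide_distrib[symmetric])
  have "emeasure lebesgue (\<phi> v) = 1" if "v \<in> V" for v
  proof -
    have "emeasure lebesgue (\<phi> v) = (\<Sum>i\<in>c v. emeasure lebesgue (I i))"
      unfolding \<phi>_def using meas fin[OF that] disjI by (intro sum_emeasure[symmetric]) auto
    also have "\<dots> = of_nat b * ennreal (1 / real b)"
      using colors(2)[OF that] by (simp add: meas)
    also have "\<dots> = 1"
      using \<open>b \<ge> 1\<close> by (simp add: ennreal_of_nat_eq_real_of_nat ennreal_mult[symmetric])
    finally show ?thesis .
  qed
  moreover have "\<phi> v \<in> sets lebesgue" if "v \<in> V" for v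
    unfolding \<phi>_def using meas fin[OF that] by auto
  moreover have "\<phi> u \<inter> \<phi> v = {}" if "{u, v} \<in> E" for u v
    using disjoint[OF that] mem unfolding \<phi>_def by auto
  ultimately have col: "fractional_coloring V E \<phi>"
    unfolding fractional_coloring_def by blast
  have "(\<Union>v\<in>V. \<phi> v) \<subseteq> {0..real k / real b}"
  proof
    fix x assume "x \<in> (\<Union>v\<in>V. \<phi> v)"
    then obtain i where i: "i < k" "x \<in> I i" using colors(1) unfolding \<phi>_def by blast
    then have "0 \<le> real i / real b" "real i / real b \<le> x" "x < (real i + 1) / real b"
      by (simp_all add: I_def)
    moreover have "(real i + 1) / real b \<le> real k / real b"
      using i(1) by (intro divide_right_mono) auto
    ultimately show "x \<in> {0..real k / real b}"
      by (meson atLeastAtMost_iff le_less_trans less_le_trans less_imp_le order_trans)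
  qed
  \<comment> \<open>Indexing by colors instead of vertices exhibits a countable union, which gives
    measurability.\<close>
  moreover have U: "(\<Union>v\<in>V. \<phi> v) = (\<Union>i\<in>(\<Union>v\<in>V. c v). I i)"
    unfolding \<phi>_def by blast
  have "(\<Union>v\<in>V. \<phi> v) \<in> sets lebesgue"
    unfolding U by (rule sets.countable_UN''[OF countableI_type meas(1)])
  ultimately have "measure lebesgue (\<Union>v\<in>V. \<phi> v) \<le> measure lebesgue {0..real k / real b}"
    by (intro measure_mono_fmeasurable) auto
  also have "\<dots> = real k / real b" by simp
  finally have "measure lebesgue (\<Union>v\<in>V. \<phi> v) \<le> real k / real b" .
  moreover have "fractional_chromatic_number V E \<le> measure lebesgue (\<Union>v\<in>V. \<phi> v)"
    unfolding fractional_chromatic_number_def using col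
    by (intro cINF_lower bdd_belowI[of _ 0]) auto
  ultimately show ?thesis by linarith
qed

theorem theorem1p1:
  fixes V :: "'a set" and E :: "'a set set" and t \<omega> :: nat
  assumes "fin_simple_graph V E"
    and "treewidth V E = t" and "t \<ge> 1"
    and "2 \<le> \<omega>" and "\<omega> \<le> t"
    and "clique_number V E \<le> \<omega>"
  shows "fractional_chromatic_number V E \<le> real t + (real \<omega> - 1) / real t"
proof -
  have "partial_t_tree t V E"
    using partial_t_tree_treewidth[OF assms(1)] assms(2) by simp
  moreover have "1 \<le> \<omega>" using assms(4) by simp
  ultimately obtain c where "\<And>v. v \<in> V \<Longrightarrow> c v \<subseteq> {..<t\<^sup>2 + \<omega> - 1}" "\<And>v. v \<in> V \<Longrightarrow> card (c v) = t"
    "\<And>u v. {u, v} \<in> E \<Longrightarrow> c u \<inter> c v = {}"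
    by (rule partial_t_tree_coloring[OF assms(1) _ assms(3) _ assms(6)]) (rule that)
  then have "fractional_chromatic_number V E \<le> real (t\<^sup>2 + \<omega> - 1) / real t"
    using fractional_chromatic_number_le_if_coloring[OF assms(3), of V c "t\<^sup>2 + \<omega> - 1" E] by simp
  \<comment> \<open>The subtraction inside \<open>real\<close> is on natural numbers; it is exact
    because \<open>2 \<le> \<omega>\<close>.\<close>
  also have "\<dots> = real t + (real \<omega> - 1) / real t"
    using assms(3,4) by (simp add: of_nat_diff power2_eq_square field_simps)
  finally show ?thesis .
qed

end
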